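(* Let $(G,K,H,E)$ be a trifactorised group and let $\sigma\colon H\to K$ be the corresponding bijective derivation. Then: (1) If $L\subseteq K$ is a subset, then $\sigma^{-1}(L)=LE\cap H$. (2) If $S\subseteq H$ is a subset, then $\sigma(S)=SE\cap K$.
   Context: A trifactorised group is a tuple $(G,K,H,E)$ with $G$ a group, $K\trianglelefteq G$, $H,E\le G$, $G=KE=KH=HE$ and $K\cap E=H\cap E=1$. Every $g\in G$ is uniquely $g=k_ge_g$ with $k_g\in K$, $e_g\in E$; the corresponding bijective derivation is the map $\sigma\colon H\to K$, $\sigma(h)=k_h$ (which is bijective). For subsets $X,Y$ of $G$, $XY=\{xy\mid x\in X,y\in Y\}$. *)

theory Defs
  imports "HOL-Algebra.Coset"
begin

definition trifactorised_group ::
    "('a, 'b) monoid_scheme \<Rightarrow> 'a set \<Rightarrow> 'a set \<Rightarrow> 'a set \<Rightarrow> bool" where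
  "trifactorised_group G K H E \<longleftrightarrow>
     group G \<and> K \<lhd> G \<and> subgroup H G \<and> subgroup E G \<and>
     carrier G = K <#>\<^bsub>G\<^esub> E \<and> carrier G = K <#>\<^bsub>G\<^esub> H \<and> carrier G = H <#>\<^bsub>G\<^esub> E \<and>
     K \<inter> E = {\<one>\<^bsub>G\<^esub>} \<and> H \<inter> E = {\<one>\<^bsub>G\<^esub>}"

text \<open>The first component of the factorisation of an element of \<open>G\<close> as an element of \<open>K\<close> times
  an element of \<open>E\<close>; unique existence is shown in \<open>trifactorised_K_part_unique\<close> below.\<close>

definition K_part ::
    "('a, 'b) monoid_scheme \<Rightarrow> 'a set \<Rightarrow> 'a set \<Rightarrow> 'a \<Rightarrow> 'a" where
  "K_part G K E g = (THE k. k \<in> K \<and> (\<exists>e\<in>E. g = k \<otimes>\<^bsub>G\<^esub> e))"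

definition trifactorised_derivation ::
    "('a, 'b) monoid_scheme \<Rightarrow> 'a set \<Rightarrow> 'a set \<Rightarrow> 'a set \<Rightarrow> 'a \<Rightarrow> 'a" where
  "trifactorised_derivation G K H E = (\<lambda>h\<in>H. K_part G K E h)"

lemma (in group) subgroups_factor_unique:
  assumes "subgroup A G" "subgroup E G" "A \<inter> E = {\<one>}"
    and "a \<in> A" "b \<in> A" "e \<in> E" "f \<in> E" "a \<otimes> e = b \<otimes> f"
  shows "a = b \<and> e = f"
proof -
  have c: "a \<in> carrier G" "b \<in> carrier G" "e \<in> carrier G" "f \<in> carrier G"
    using assms by (auto dest: subgroup.mem_carrier)
  have "inv b \<otimes> a = (inv b \<otimes> (a \<otimes> e)) \<otimes> inv e"
    using c by (simp add: m_assoc)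
  also have "\<dots> = (inv b \<otimes> (b \<otimes> f)) \<otimes> inv e"
    using assms by simp
  also have "\<dots> = f \<otimes> inv e"
    using c by (simp add: m_assoc[symmetric])
  finally have eq: "inv b \<otimes> a = f \<otimes> inv e" .
  have "inv b \<otimes> a \<in> A" "f \<otimes> inv e \<in> E"
    using assms by (auto intro: subgroup.m_closed subgroup.m_inv_closed)
  with eq assms(3) have "inv b \<otimes> a = \<one>" by auto
  with c have "a = b" by (metis inv_closed inv_equality inv_inv)
  with assms(8) c show ?thesis by simp
qed

lemma trifactorised_K_part_unique:
  assumes "trifactorised_group G K H E" "g \<in> carrier G"
  shows "\<exists>!k. k \<in> K \<and> (\<exists>e\<in>E. g = k \<otimes>\<^bsub>G\<^esub> e)"
proof -
  interpret group G using assms by (simp add: trifactorised_group_def)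
  have s: "subgroup K G" "subgroup E G" "K \<inter> E = {\<one>\<^bsub>G\<^esub>}"
    using assms by (auto simp: trifactorised_group_def normal_imp_subgroup)
  have "g \<in> K <#>\<^bsub>G\<^esub> E" using assms by (simp add: trifactorised_group_def)
  then obtain k e where "k \<in> K" "e \<in> E" "g = k \<otimes>\<^bsub>G\<^esub> e"
    by (auto simp: set_mult_def)
  then show ?thesis
    using subgroups_factor_unique[OF s] by blast
qed

lemma trifactorised_derivation_eq:
  assumes "trifactorised_group G K H E" "h \<in> H" "k \<in> K" "e \<in> E" "h = k \<otimes>\<^bsub>G\<^esub> e"
  shows "trifactorised_derivation G K H E h = k"
proof -
  have "h \<in> carrier G"
    using assms by (auto simp: trifactorised_group_def dest: subgroup.mem_carrier)
  from the1_equality[OF trifactorised_K_part_unique[OF assms(1) this], of k] assms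
  show ?thesis by (auto simp: trifactorised_derivation_def K_part_def)
qed

lemma trifactorised_derivation_factor:
  assumes "trifactorised_group G K H E" "h \<in> H"
  obtains e where "trifactorised_derivation G K H E h \<in> K" "e \<in> E"
    "h = trifactorised_derivation G K H E h \<otimes>\<^bsub>G\<^esub> e"
proof -
  have "h \<in> carrier G"
    using assms by (auto simp: trifactorised_group_def dest: subgroup.mem_carrier)
  from theI'[OF trifactorised_K_part_unique[OF assms(1) this]] assms(2) that
  show ?thesis by (auto simp: trifactorised_derivation_def K_part_def)
qed

lemma trifactorised_derivation_bij_betw:
  assumes t: "trifactorised_group G K H E"
  shows "bij_betw (trifactorised_derivation G K H E) H K"
proof -
  let ?s = "trifactorised_derivation G K H E"
  interpret group G using t by (simp add: trifactorised_group_def)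
  have s: "subgroup K G" "subgroup H G" "subgroup E G" "H \<inter> E = {\<one>\<^bsub>G\<^esub>}"
    using t by (auto simp: trifactorised_group_def normal_imp_subgroup)
  have mem: "x \<in> carrier G" if "x \<in> K \<or> x \<in> H \<or> x \<in> E" for x
    using that s by (auto dest: subgroup.mem_carrier)
  have cancel: "x \<otimes>\<^bsub>G\<^esub> inv\<^bsub>G\<^esub> e = k" if "x = k \<otimes>\<^bsub>G\<^esub> e" "k \<in> K \<or> k \<in> H" "e \<in> E" for x k e
    using that mem by (auto simp: m_assoc)
  have "inj_on ?s H"
  proof (rule inj_onI)
    fix x y assume xy: "x \<in> H" "y \<in> H" "?s x = ?s y"
    obtain e where e: "?s x \<in> K" "e \<in> E" "x = ?s x \<otimes>\<^bsub>G\<^esub> e"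
      using trifactorised_derivation_factor[OF t xy(1)] .
    obtain f where f: "f \<in> E" "y = ?s y \<otimes>\<^bsub>G\<^esub> f"
      using trifactorised_derivation_factor[OF t xy(2)] by metis
    have "x \<otimes>\<^bsub>G\<^esub> inv\<^bsub>G\<^esub> e = y \<otimes>\<^bsub>G\<^esub> inv\<^bsub>G\<^esub> f"
      using cancel[OF e(3)] cancel[OF f(2)] e f xy by simp
    then show "x = y"
      using subgroups_factor_unique[OF s(2-4) xy(1,2)] e f s
      by (auto intro: subgroup.m_inv_closed)
  qed
  moreover have "?s ` H \<subseteq> K"
    using trifactorised_derivation_factor[OF t] by blast
  moreover have "K \<subseteq> ?s ` H"
  proof
    fix k assume k: "k \<in> K"
    have "k \<in> H <#>\<^bsub>G\<^esub> E" using t mem[of k] k unfolding trifactorised_group_def by blast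
    then obtain h e where he: "h \<in> H" "e \<in> E" "k = h \<otimes>\<^bsub>G\<^esub> e"
      by (auto simp: set_mult_def)
    have "h = k \<otimes>\<^bsub>G\<^esub> inv\<^bsub>G\<^esub> e" using cancel[OF he(3)] he by simp
    then have "?s h = k"
      using trifactorised_derivation_eq[OF t he(1) k] he s subgroup.m_inv_closed by metis
    then show "k \<in> ?s ` H" using he by blast
  qed
  ultimately show ?thesis by (auto simp: bij_betw_def)
qed

end

theory Submission
  imports Defs
begin

text \<open>For \<open>h \<in> H\<close> and \<open>k \<in> K\<close>, the equation \<open>\<sigma> h = k\<close> says exactly that \<open>h\<close> and \<open>k\<close> lie in the
  same left coset of \<open>E\<close>. This relation is symmetric in \<open>h\<close> and \<open>k\<close>, because \<open>E\<close> is closed under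
  inverses, so it can be read as \<open>h \<in> kE\<close> or as \<open>k \<in> hE\<close>. Letting \<open>k\<close> range over \<open>L\<close> in the first
  reading gives the preimage formula, and letting \<open>h\<close> range over \<open>S\<close> in the second gives the image
  formula.\<close>

lemma trifactorised_derivation_eq_iff:
  assumes t: "trifactorised_group G K H E" and "h \<in> H" "k \<in> K"
  shows "trifactorised_derivation G K H E h = k \<longleftrightarrow> (\<exists>e\<in>E. h = k \<otimes>\<^bsub>G\<^esub> e)"
proof
  obtain e where e: "e \<in> E" "h = trifactorised_derivation G K H E h \<otimes>\<^bsub>G\<^esub> e"
    by (rule trifactorised_derivation_factor[OF assms(1,2)])
  show "\<exists>e\<in>E. h = k \<otimes>\<^bsub>G\<^esub> e" if "trifactorised_derivation G K H E h = k"
    using e unfolding that ..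
  show "trifactorised_derivation G K H E h = k" if "\<exists>e\<in>E. h = k \<otimes>\<^bsub>G\<^esub> e"
    using that trifactorised_derivation_eq[OF assms] by blast
qed

text \<open>If \<open>x = y e\<close> then \<open>y = x e\<^sup>-\<^sup>1\<close>; being in the same left coset is symmetric.\<close>

lemma (in group) subgroup_factor_swap:
  assumes E: "subgroup E G" and x: "x \<in> carrier G" and y: "y \<in> carrier G"
  shows "(\<exists>e\<in>E. x = y \<otimes> e) \<longleftrightarrow> (\<exists>e\<in>E. y = x \<otimes> e)"
proof -
  have "\<exists>e\<in>E. b = a \<otimes> e" if "e \<in> E" "a = b \<otimes> e" "b \<in> carrier G" for a b e
  proof
    show "inv e \<in> E" using E that(1) by (rule subgroup.m_inv_closed)
    show "b = a \<otimes> inv e"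
      using that subgroup.mem_carrier[OF E that(1)] by (simp add: m_assoc)
  qed
  with x y show ?thesis by blast
qed

theorem proposition5p1:
  fixes G :: "('a, 'b) monoid_scheme" and K H E :: "'a set" and \<sigma> :: "'a \<Rightarrow> 'a"
  assumes "trifactorised_group G K H E"
    and "\<sigma> = trifactorised_derivation G K H E"
  shows "(\<forall>L. L \<subseteq> K \<longrightarrow> \<sigma> -` L \<inter> H = (L <#>\<^bsub>G\<^esub> E) \<inter> H) \<and>
         (\<forall>S. S \<subseteq> H \<longrightarrow> \<sigma> ` S = (S <#>\<^bsub>G\<^esub> E) \<inter> K)"
proof -
  interpret group G using assms(1) by (simp add: trifactorised_group_def)
  have sub: "subgroup K G" "subgroup H G" "subgroup E G"
    using assms(1) by (auto simp: trifactorised_group_def normal_imp_subgroup)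
  have K: "\<sigma> h \<in> K" if "h \<in> H" for h
    unfolding assms(2) by (rule trifactorised_derivation_factor[OF assms(1) that])
  have left: "\<sigma> h = k \<longleftrightarrow> (\<exists>e\<in>E. h = k \<otimes>\<^bsub>G\<^esub> e)" if "h \<in> H" "k \<in> K" for h k
    unfolding assms(2) using trifactorised_derivation_eq_iff[OF assms(1) that] .
  have right: "\<sigma> h = k \<longleftrightarrow> (\<exists>e\<in>E. k = h \<otimes>\<^bsub>G\<^esub> e)" if "h \<in> H" "k \<in> K" for h k
    unfolding left[OF that]
    using that sub by (intro subgroup_factor_swap) (auto dest: subgroup.mem_carrier)
  have mult: "x \<in> A <#>\<^bsub>G\<^esub> E \<longleftrightarrow> (\<exists>a\<in>A. \<exists>e\<in>E. x = a \<otimes>\<^bsub>G\<^esub> e)" for x A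
    by (auto simp: set_mult_def)
  have "\<sigma> -` L \<inter> H = (L <#>\<^bsub>G\<^esub> E) \<inter> H" if L: "L \<subseteq> K" for L
  proof -
    have "\<sigma> h \<in> L \<longleftrightarrow> h \<in> L <#>\<^bsub>G\<^esub> E" if "h \<in> H" for h
    proof -
      have "\<sigma> h \<in> L \<longleftrightarrow> (\<exists>k\<in>L. \<sigma> h = k)" by simp
      also have "\<dots> \<longleftrightarrow> h \<in> L <#>\<^bsub>G\<^esub> E"
        unfolding mult by (rule bex_cong[OF refl], rule left[OF that subsetD[OF L]])
      finally show ?thesis .
    qed
    then show ?thesis by blast
  qed
  moreover have "\<sigma> ` S = (S <#>\<^bsub>G\<^esub> E) \<inter> K" if S: "S \<subseteq> H" for S
  proof -
    have "k \<in> \<sigma> ` S \<longleftrightarrow> k \<in> S <#>\<^bsub>G\<^esub> E" if "k \<in> K" for k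
    proof -
      have "k \<in> \<sigma> ` S \<longleftrightarrow> (\<exists>h\<in>S. \<sigma> h = k)" by (simp add: image_iff eq_commute)
      also have "\<dots> \<longleftrightarrow> k \<in> S <#>\<^bsub>G\<^esub> E"
        unfolding mult by (rule bex_cong[OF refl], rule right[OF subsetD[OF S] that])
      finally show ?thesis .
    qed
    moreover have "\<sigma> ` S \<subseteq> K" using K S by blast
    ultimately show ?thesis by blast
  qed
  ultimately show ?thesis by blast
qed

end
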